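(* Let $g:\mathbb{R}\to\mathbb{R}$ be a derivator and fix some $x_0\in\mathbb{R}$. For all $n\in\mathbb{N}$ and $x\in\mathbb{R}$, $$g_n(x)=\sum_{k=0}^n\binom{n}{k}g^C_k(x)\,g^B_{n-k}(x).$$
   Context: A derivator is a left-continuous non-decreasing function $g:\mathbb{R}\to\mathbb{R}$; $\Delta g(x)=g(x^+)-g(x)$. $\mu_g$ denotes its Lebesgue–Stieltjes measure, characterized on Borel sets by $\mu_g([a,b))=g(b)-g(a)$ for $a<b$. For any derivator $h$, the $h$-monomials centered at $x_0$ are $h_{x_0,0}\equiv 1$ and, for $n\ge 1$, $h_{x_0,n}(x)=n\int_{[x_0,x)}h_{x_0,n-1}\,d\mu_h$ if $x\ge x_0$ and $h_{x_0,n}(x)=-n\int_{[x,x_0)}h_{x_0,n-1}\,d\mu_h$ if $x<x_0$. The discontinuous part of $g$ is $g^B(x)=\sum_{s\in[0,x)}\Delta g(s)$ for $x>0$ and $g^B(x)=-\sum_{s\in[x,0)}\Delta g(s)$ for $x\le 0$; the continuous part is $g^C=g-g^B$. Both are derivators. Write $g_n=g_{x_0,n}$, $g^C_n=(g^C)_{x_0,n}$, $g^B_n=(g^B)_{x_0,n}$. *)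

theory Defs
  imports "HOL-Analysis.Analysis"
begin

definition derivator :: "(real \<Rightarrow> real) \<Rightarrow> bool" where
  "derivator g \<longleftrightarrow> mono g \<and> (\<forall>x. continuous (at_left x) g)"

(* interval_measure expects a right-continuous function F and assigns F b - F a to {a<..b}.
   For left-continuous g, the function - g (- t) is right-continuous, and reflecting its
   interval measure at 0 yields the measure with value g b - g a on {a..<b}; see
   emeasure_stieltjes and stieltjes_unique. *)
definition stieltjes :: "(real \<Rightarrow> real) \<Rightarrow> real measure" where
  "stieltjes g = distr (interval_measure (\<lambda>t. - g (- t))) borel uminus"

lemma sets_stieltjes [simp, measurable_cong]: "sets (stieltjes g) = sets borel"
  by (simp add: stieltjes_def)

lemma space_stieltjes [simp]: "space (stieltjes g) = UNIV"
  by (simp add: stieltjes_def)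

lemma emeasure_stieltjes:
  assumes "derivator g" and "a \<le> b"
  shows "emeasure (stieltjes g) {a..<b} = ennreal (g b - g a)"
proof -
  have mono: "- g (- s) \<le> - g (- t)" if "s \<le> t" for s t
    using assms(1) that by (auto simp: derivator_def mono_def)
  have cont: "continuous (at_right t) (\<lambda>t. - g (- t))" for t
  proof -
    have "filterlim g (nhds (g (- t))) (at_left (- t))"
      using assms(1) by (auto simp: derivator_def continuous_within)
    then have "((\<lambda>t. g (- t)) \<longlongrightarrow> g (- t)) (at_right t)"
      by (simp add: filterlim_at_left_to_right)
    then show ?thesis
      by (auto simp: continuous_within intro!: tendsto_minus)
  qed
  have "uminus -` {a..<b} = {- b<..- a}"
    by auto
  then have "emeasure (stieltjes g) {a..<b} =
      emeasure (interval_measure (\<lambda>t. - g (- t))) {- b<..- a}"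
    by (simp add: stieltjes_def emeasure_distr)
  also have "\<dots> = ennreal (g b - g a)"
    using emeasure_interval_measure_Ioc[of "- b" "- a" "\<lambda>t. - g (- t)"] assms(2) mono cont
    by simp
  finally show ?thesis .
qed

lemma stieltjes_unique:
  assumes g: "derivator g" and sets: "sets M = sets borel"
    and M: "\<And>a b. a < b \<Longrightarrow> emeasure M {a..<b} = ennreal (g b - g a)"
  shows "M = stieltjes g"
proof (rule measure_eqI_generator_eq[where \<Omega> = UNIV and E = "range (\<lambda>(a, b). {a..<b})"
      and A = "\<lambda>n::nat. {- real n..<real n}"])
  show "Int_stable (range (\<lambda>(a::real, b). {a..<b}))"
    by (auto simp: Int_stable_def)
  show "X \<in> range (\<lambda>(a, b). {a..<b}) \<Longrightarrow> emeasure M X = emeasure (stieltjes g) X" for X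
  proof -
    assume "X \<in> range (\<lambda>(a, b). {a..<b})"
    then obtain a b where X: "X = {a..<b}" by auto
    show "emeasure M X = emeasure (stieltjes g) X"
      using M[of a b] emeasure_stieltjes[OF g, of a b] by (cases "a < b") (auto simp: X)
  qed
  have borel: "sets borel = sigma_sets UNIV (range (\<lambda>(a::real, b). {a..<b}))"
    unfolding borel_eq_atLeastLessThan by simp
  show "sets M = sigma_sets UNIV (range (\<lambda>(a, b). {a..<b}))"
    "sets (stieltjes g) = sigma_sets UNIV (range (\<lambda>(a, b). {a..<b}))"
    by (simp_all add: sets borel)
  show "(\<Union>n::nat. {- real n..<real n}) = UNIV"
  proof -
    have "\<exists>n::nat. - real n \<le> x \<and> x < real n" for x
    proof -
      obtain n :: nat where "\<bar>x\<bar> < real n"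
        using reals_Archimedean2 by blast
      then show ?thesis by (intro exI[of _ n]) auto
    qed
    then show ?thesis by auto
  qed
  show "emeasure M {- real n..<real n} \<noteq> \<infinity>" for n :: nat
    using M[of "- real n" "real n"] by (cases "n = 0") auto
qed auto

primrec monomial :: "(real \<Rightarrow> real) \<Rightarrow> real \<Rightarrow> nat \<Rightarrow> real \<Rightarrow> real" where
  "monomial h x0 0 = (\<lambda>x. 1)"
| "monomial h x0 (Suc n) = (\<lambda>x.
     if x0 \<le> x then real (Suc n) * (LINT t:{x0..<x}|stieltjes h. monomial h x0 n t)
     else - real (Suc n) * (LINT t:{x..<x0}|stieltjes h. monomial h x0 n t))"

definition jump :: "(real \<Rightarrow> real) \<Rightarrow> real \<Rightarrow> real" where
  "jump g x = Lim (at_right x) g - g x"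

definition disc_part :: "(real \<Rightarrow> real) \<Rightarrow> real \<Rightarrow> real" where
  "disc_part g x = (if 0 < x then (\<Sum>\<^sub>\<infinity>s\<in>{0..<x}. jump g s)
                    else - (\<Sum>\<^sub>\<infinity>s\<in>{x..<0}. jump g s))"

definition cont_part :: "(real \<Rightarrow> real) \<Rightarrow> real \<Rightarrow> real" where
  "cont_part g x = g x - disc_part g x"

end

(* The continuous part of g has no atoms, so for f and h integrable against the measures of
   g^C and g^B the double integral of f(s) h(t) does not see the diagonal s = t. Splitting it
   along the diagonal gives the product rule d(UV) = U dV + V dU for the indefinite integrals
   U and V, without the jump correction that it has in general. As the measure of g is the sum
   of the measures of g^C and g^B, induction on n with the absorption identities
   k C(n,k) = n C(n-1,k-1) and (n-k) C(n,k) = n C(n-1,k) turns this into the binomial formula. *)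
theory Submission
  imports Defs
begin

section \<open>The continuous and the discontinuous part\<close>

text \<open>\<open>jump\<close> is defined through \<open>Lim\<close>, which is informative only
  where a limit exists. Monotonicity supplies it: the right-hand limit is the infimum of the values
  to the right of \<open>x\<close>.\<close>

lemma mono_at_right_lim:
  fixes g :: "real \<Rightarrow> real"
  assumes "mono g"
  shows "(g \<longlongrightarrow> g x + jump g x) (at_right x)"
proof -
  have "(g \<longlongrightarrow> Inf (g ` ({x<..} \<inter> UNIV))) (at x within ({x<..} \<inter> UNIV))"
    by (rule Lim_right_bound[where K = "g x"]) (use assms in \<open>auto simp: mono_def\<close>)
  then have *: "(g \<longlongrightarrow> Inf (g ` {x<..})) (at_right x)"
    by simp
  moreover have "Lim (at_right x) g = Inf (g ` {x<..})"
    by (rule tendsto_Lim[OF _ *]) simp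
  ultimately show ?thesis
    by (simp add: jump_def)
qed

lemma jump_nonneg:
  assumes "mono g"
  shows "0 \<le> jump g x"
proof -
  have "g x \<le> g x + jump g x"
    by (rule tendsto_lowerbound[OF mono_at_right_lim[OF assms]])
      (use assms in \<open>auto simp: eventually_at_right_field mono_def intro!: exI[of _ "x + 1"]\<close>)
  then show ?thesis by simp
qed

lemma jump_le:
  assumes "mono g" "x < y"
  shows "jump g x \<le> g y - g x"
proof -
  have "g x + jump g x \<le> g y"
    by (rule tendsto_upperbound[OF mono_at_right_lim[OF assms(1)]])
      (use assms in \<open>auto simp: eventually_at_right_field mono_def intro!: exI[of _ y]\<close>)
  then show ?thesis by simp
qed

text \<open>Telescoping at the largest point \<open>m\<close>: the earlier jumps fit into the growth
  of \<open>g\<close> from \<open>a\<close> to \<open>m\<close>, and the jump at \<open>m\<close>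
  fits into the growth from \<open>m\<close> to \<open>b\<close>.\<close>

lemma sum_jump_le:
  assumes "mono g" "finite F" "F \<subseteq> {a..<b}" "a \<le> b"
  shows "sum (jump g) F \<le> g b - g a"
  using assms(2-4)
proof (induction F arbitrary: b rule: finite_linorder_max_induct)
  case empty
  then show ?case using assms(1) by (simp add: mono_def)
next
  case (insert m A)
  have "sum (jump g) A \<le> g m - g a"
    by (rule insert.IH) (use insert in auto)
  moreover have "jump g m \<le> g b - g m"
    by (rule jump_le) (use assms insert in auto)
  ultimately show ?case using insert by auto
qed

text \<open>Nonnegative terms with bounded finite sums. This secures all later sums of jumps, since
  \<open>infsum\<close> takes the default value 0 where summability fails.\<close>

lemma jump_summable_on:
  assumes "mono g"
  shows "jump g summable_on {a..<b}"
proof (cases "a \<le> b")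
  case True
  show ?thesis
    by (rule nonneg_bdd_above_summable_on)
      (use assms True jump_nonneg sum_jump_le in \<open>auto intro!: bdd_aboveI[of _ "g b - g a"]\<close>)
qed simp

lemma infsum_jump_le:
  assumes "mono g" "a \<le> b"
  shows "(\<Sum>\<^sub>\<infinity>s\<in>{a..<b}. jump g s) \<le> g b - g a"
  by (rule infsum_le_finite_sums) (use assms jump_summable_on sum_jump_le in auto)

text \<open>The origin only normalises \<open>disc_part\<close>; it cancels in increments, whether
  it lies to the left of the interval, inside it or to the right.\<close>

lemma disc_part_diff:
  assumes "mono g" "a \<le> b"
  shows "disc_part g b - disc_part g a = (\<Sum>\<^sub>\<infinity>s\<in>{a..<b}. jump g s)"
proof -
  have split: "(\<Sum>\<^sub>\<infinity>s\<in>{r..<t}. jump g s) = (\<Sum>\<^sub>\<infinity>s\<in>{r..<u}. jump g s) + (\<Sum>\<^sub>\<infinity>s\<in>{u..<t}. jump g s)"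
    if "r \<le> u" "u \<le> t" for r u t
  proof -
    have "{r..<t} = {r..<u} \<union> {u..<t}" using that by auto
    then show ?thesis
      using infsum_Un_disjoint[OF jump_summable_on[OF assms(1)] jump_summable_on[OF assms(1)], of r u u t]
      by simp
  qed
  consider "0 < a" | "a \<le> 0" "0 < b" | "b \<le> 0" by linarith
  then show ?thesis
  proof cases
    case 1
    then show ?thesis using split[of 0 a b] assms by (simp add: disc_part_def)
  next
    case 2
    then show ?thesis using split[of a 0 b] by (simp add: disc_part_def)
  next
    case 3
    then show ?thesis using split[of a b 0] assms by (simp add: disc_part_def)
  qed
qed

section \<open>The two parts as derivators, and their measures\<close>

lemma derivator_add:
  assumes "derivator u" "derivator v"
  shows "derivator (\<lambda>x. u x + v x)"
  using assms by (auto simp: derivator_def mono_def add_mono intro: continuous_add)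

text \<open>As \<open>t\<close> increases to \<open>x\<close>, \<open>h t\<close> is squeezed
  between \<open>h x - (g x - g t)\<close> and \<open>h x\<close>, so left-continuity passes from
  \<open>g\<close> to \<open>h\<close>. This serves both parts of a derivator, as each grows at most
  as fast as the whole.\<close>

lemma derivator_dominated:
  assumes "derivator g" "mono h" and le: "\<And>a b. a \<le> b \<Longrightarrow> h b - h a \<le> g b - g a"
  shows "derivator h"
proof -
  have "(h \<longlongrightarrow> h x) (at_left x)" for x
  proof -
    have "(g \<longlongrightarrow> g x) (at_left x)"
      using assms(1) by (auto simp: derivator_def continuous_within)
    then have lim: "((\<lambda>t. h x - (g x - g t)) \<longlongrightarrow> h x - (g x - g x)) (at_left x)"
      by (intro tendsto_intros)
    show ?thesis
    proof (rule real_tendsto_sandwich[OF _ _ _ tendsto_const])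
      show "((\<lambda>t. h x - (g x - g t)) \<longlongrightarrow> h x) (at_left x)" using lim by simp
      show "\<forall>\<^sub>F t in at_left x. h x - (g x - g t) \<le> h t"
        using le by (auto simp: eventually_at_left_field algebra_simps intro!: exI[of _ "x - 1"])
      show "\<forall>\<^sub>F t in at_left x. h t \<le> h x"
        using assms(2) by (auto simp: eventually_at_left_field mono_def intro!: exI[of _ "x - 1"])
    qed
  qed
  then show ?thesis using assms(2) by (auto simp: derivator_def continuous_within)
qed

lemma derivator_disc_part:
  assumes "derivator g"
  shows "derivator (disc_part g)"
proof (rule derivator_dominated[OF assms])
  have g: "mono g" using assms by (simp add: derivator_def)
  show "mono (disc_part g)"
  proof (rule monoI)
    fix a b :: real
    assume "a \<le> b"
    then show "disc_part g a \<le> disc_part g b"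
      using disc_part_diff[OF g, of a b] infsum_nonneg[of "{a..<b}" "jump g"] jump_nonneg[OF g] by simp
  qed
  show "disc_part g b - disc_part g a \<le> g b - g a" if "a \<le> b" for a b
    using disc_part_diff[OF g that] infsum_jump_le[OF g that] by simp
qed

lemma derivator_cont_part:
  assumes "derivator g"
  shows "derivator (cont_part g)"
proof (rule derivator_dominated[OF assms])
  have g: "mono g" using assms by (simp add: derivator_def)
  have B: "mono (disc_part g)"
    using derivator_disc_part[OF assms] by (simp add: derivator_def)
  show "mono (cont_part g)"
  proof (rule monoI)
    fix a b :: real
    assume "a \<le> b"
    then show "cont_part g a \<le> cont_part g b"
      using disc_part_diff[OF g, of a b] infsum_jump_le[OF g, of a b] by (simp add: cont_part_def)
  qed
  show "cont_part g b - cont_part g a \<le> g b - g a" if "a \<le> b" for a b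
    using monoD[OF B that] by (simp add: cont_part_def)
qed

text \<open>Subtracting the discontinuous part removes at least the jump at \<open>x\<close> from
  the growth over \<open>{x..<t}\<close>. What is left is at most
  \<open>g t - g x - jump g x\<close>, which tends to 0 as \<open>t\<close> decreases to
  \<open>x\<close>.\<close>

lemma emeasure_stieltjes_cont_part_singleton:
  assumes "derivator g"
  shows "emeasure (stieltjes (cont_part g)) {x} = 0"
proof -
  have g: "mono g" using assms by (simp add: derivator_def)
  have "emeasure (stieltjes (cont_part g)) {x} \<le> ennreal (g t - g x - jump g x)" if "x < t" for t
  proof -
    have "jump g x \<le> (\<Sum>\<^sub>\<infinity>s\<in>{x..<t}. jump g s)"
      using finite_sum_le_infsum[OF jump_summable_on[OF g], of "{x}" x t] that jump_nonneg[OF g] by auto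
    then have "cont_part g t - cont_part g x \<le> g t - g x - jump g x"
      using disc_part_diff[OF g, of x t] that by (simp add: cont_part_def)
    moreover have "emeasure (stieltjes (cont_part g)) {x} \<le> emeasure (stieltjes (cont_part g)) {x..<t}"
      using that by (intro emeasure_mono) auto
    ultimately show ?thesis
      using emeasure_stieltjes[OF derivator_cont_part[OF assms], of x t] that
      by (simp add: order_trans[OF _ ennreal_leI])
  qed
  moreover have "((\<lambda>t. ennreal (g t - g x - jump g x)) \<longlongrightarrow> ennreal (g x + jump g x - g x - jump g x)) (at_right x)"
    by (intro tendsto_intros mono_at_right_lim[OF g])
  ultimately have "emeasure (stieltjes (cont_part g)) {x} \<le> ennreal (g x + jump g x - g x - jump g x)"
    by (intro tendsto_lowerbound[where F = "at_right x"])
      (auto simp: eventually_at_right_field intro!: exI[of _ "x + 1"])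
  then show ?thesis by simp
qed

text \<open>The sum of the two measures is itself a measure with the required values on half-open
  intervals, so \<open>stieltjes_unique\<close> identifies it.\<close>

lemma emeasure_stieltjes_add:
  assumes "derivator u" "derivator v" "A \<in> sets borel"
  shows "emeasure (stieltjes (\<lambda>x. u x + v x)) A = emeasure (stieltjes u) A + emeasure (stieltjes v) A"
proof -
  let ?\<mu> = "\<lambda>A. emeasure (stieltjes u) A + emeasure (stieltjes v) A"
  define M where "M = measure_of UNIV (sets borel) ?\<mu>"
  have M: "emeasure M A = ?\<mu> A" if "A \<in> sets borel" for A
    unfolding M_def
  proof (rule emeasure_measure_of_sigma[OF _ _ _ that])
    show "sigma_algebra UNIV (sets (borel::real measure))"
      using sets.sigma_algebra_axioms[of "borel::real measure"] by simp
    show "positive (sets borel) ?\<mu>" by (simp add: positive_def)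
    show "countably_additive (sets borel) ?\<mu>"
      by (auto simp: countably_additive_def suminf_add[symmetric] suminf_emeasure)
  qed
  note derivator_add[OF assms(1,2)]
  moreover have "sets M = sets borel"
    using sets.sigma_sets_eq[of "borel::real measure"] by (simp add: M_def)
  moreover have "emeasure M {a..<b} = ennreal (u b + v b - (u a + v a))" if "a < b" for a b
  proof -
    have "u a \<le> u b" "v a \<le> v b" using assms(1,2) that by (auto simp: derivator_def mono_def)
    then show ?thesis
      using that assms(1,2) by (simp add: M emeasure_stieltjes flip: ennreal_plus)
  qed
  ultimately have "M = stieltjes (\<lambda>x. u x + v x)" by (rule stieltjes_unique)
  then show ?thesis using M[OF assms(3)] by simp
qed

lemma sigma_finite_stieltjes:
  assumes "derivator g"
  shows "sigma_finite_measure (stieltjes g)"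
proof (unfold_locales, intro exI conjI)
  let ?A = "range (\<lambda>n::nat. {- real n..<real n})"
  show "countable ?A" "?A \<subseteq> sets (stieltjes g)" by auto
  show "\<forall>a\<in>?A. emeasure (stieltjes g) a \<noteq> \<infinity>"
    using emeasure_stieltjes[OF assms] by auto
  have "\<exists>n::nat. - real n \<le> x \<and> x < real n" for x
  proof -
    obtain n :: nat where "\<bar>x\<bar> < real n" using reals_Archimedean2 by blast
    then show ?thesis by (intro exI[of _ n]) auto
  qed
  then show "\<Union> ?A = space (stieltjes g)" by auto
qed

section \<open>Products of integrals split along the diagonal\<close>

text \<open>Fubini with opposite orders on the two pieces: \<open>M1\<close> is innermost on
  \<open>Q\<close>, \<open>M2\<close> on its complement. \<open>Q\<close> stays general so that the
  diagonal can later be put on either side.\<close>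

lemma (in pair_sigma_finite) integral_mult_split:
  fixes f :: "'a \<Rightarrow> real" and h :: "'b \<Rightarrow> real"
  assumes f: "integrable M1 f" and h: "integrable M2 h" and [measurable]: "Q \<in> sets (M1 \<Otimes>\<^sub>M M2)"
  shows "(\<integral>s. f s \<partial>M1) * (\<integral>t. h t \<partial>M2) =
    (\<integral>t. h t * (\<integral>s. indicator Q (s, t) * f s \<partial>M1) \<partial>M2) +
    (\<integral>s. f s * (\<integral>t. indicator (- Q) (s, t) * h t \<partial>M2) \<partial>M1)"
proof -
  note [measurable] = borel_measurable_integrable[OF f] borel_measurable_integrable[OF h]
  let ?\<phi> = "\<lambda>(s, t). f s * h t"
  have \<phi>: "integrable (M1 \<Otimes>\<^sub>M M2) ?\<phi>"
    by (rule Fubini_integrable) (use f h in \<open>auto simp: abs_mult\<close>)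
  have Q: "integrable (M1 \<Otimes>\<^sub>M M2) (\<lambda>(s, t). indicator Q (s, t) * (f s * h t))"
    using integrable_mult_indicator[OF assms(3) \<phi>] by (simp add: case_prod_unfold)
  \<comment> \<open>\<open>- Q\<close> may contain points outside the product space, so
    integrability there comes from subtraction and not from measurability of the set.\<close>
  have "integrable (M1 \<Otimes>\<^sub>M M2) (\<lambda>p. ?\<phi> p - (\<lambda>(s, t). indicator Q (s, t) * (f s * h t)) p)"
    by (rule Bochner_Integration.integrable_diff[OF \<phi> Q])
  moreover have "?\<phi> p - (\<lambda>(s, t). indicator Q (s, t) * (f s * h t)) p =
      (\<lambda>(s, t). indicator (- Q) (s, t) * (f s * h t)) p" for p
    by (cases p) (simp add: indicator_def)
  ultimately have Q': "integrable (M1 \<Otimes>\<^sub>M M2) (\<lambda>(s, t). indicator (- Q) (s, t) * (f s * h t))"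
    by simp
  have "(\<integral>s. f s \<partial>M1) * (\<integral>t. h t \<partial>M2) = integral\<^sup>L (M1 \<Otimes>\<^sub>M M2) ?\<phi>"
    using integral_fst[OF \<phi>] by simp
  also have "\<dots> = integral\<^sup>L (M1 \<Otimes>\<^sub>M M2) (\<lambda>(s, t). indicator Q (s, t) * (f s * h t)) +
      integral\<^sup>L (M1 \<Otimes>\<^sub>M M2) (\<lambda>(s, t). indicator (- Q) (s, t) * (f s * h t))"
    by (subst Bochner_Integration.integral_add[OF Q Q', symmetric])
      (auto intro!: Bochner_Integration.integral_cong split: split_indicator)
  also have "integral\<^sup>L (M1 \<Otimes>\<^sub>M M2) (\<lambda>(s, t). indicator Q (s, t) * (f s * h t)) =
      (\<integral>t. h t * (\<integral>s. indicator Q (s, t) * f s \<partial>M1) \<partial>M2)"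
    by (subst integral_snd[OF Q, symmetric])
      (simp add: mult.assoc[symmetric] mult.commute[of "h _"])
  also have "integral\<^sup>L (M1 \<Otimes>\<^sub>M M2) (\<lambda>(s, t). indicator (- Q) (s, t) * (f s * h t)) =
      (\<integral>s. f s * (\<integral>t. indicator (- Q) (s, t) * h t \<partial>M2) \<partial>M1)"
    by (subst integral_fst'[OF Q', symmetric])
      (simp add: mult.left_commute[of _ "f _"])
  finally show ?thesis .
qed

text \<open>The product measure of the diagonal can be computed by slicing in either direction. The
  slices measured by \<open>M1\<close> are null, so the nonnegative function
  \<open>emeasure M2 {s}\<close> has integral 0 over \<open>M1\<close>.\<close>

lemma AE_no_common_atom:
  fixes M1 M2 :: "real measure"
  assumes "sigma_finite_measure M1" "sigma_finite_measure M2"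
    and [measurable_cong]: "sets M1 = sets borel" "sets M2 = sets borel"
    and atomless: "\<And>x. emeasure M1 {x} = 0"
  shows "AE s in M1. emeasure M2 {s} = 0"
proof -
  interpret M1: sigma_finite_measure M1 by fact
  interpret M2: sigma_finite_measure M2 by fact
  interpret pair_sigma_finite M1 M2 ..
  have sp: "space M1 = UNIV" "space M2 = UNIV"
    using sets_eq_imp_space_eq[OF assms(3)] sets_eq_imp_space_eq[OF assms(4)] by simp_all
  let ?D = "{p \<in> space (M1 \<Otimes>\<^sub>M M2). fst p = snd p}"
  have D[measurable]: "?D \<in> sets (M1 \<Otimes>\<^sub>M M2)"
    by measurable
  have vim: "Pair s -` ?D = {s}" "(\<lambda>s. (s, t)) -` ?D = {t}" for s t
    by (auto simp: space_pair_measure sp)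
  have meas: "(\<lambda>s. emeasure M2 {s}) \<in> borel_measurable M1"
    using M2.measurable_emeasure_Pair[OF D] by (simp only: vim)
  have "(\<integral>\<^sup>+s. emeasure M2 {s} \<partial>M1) = (\<integral>\<^sup>+t. emeasure M1 {t} \<partial>M2)"
    using M2.emeasure_pair_measure_alt[OF D] emeasure_pair_measure_alt2[OF D]
    by (simp only: vim)
  then show ?thesis
    using atomless by (simp add: nn_integral_0_iff_AE[OF meas])
qed

text \<open>The first form, with inner integrals starting at \<open>a\<close>, is for points to the
  right of the centre; the second, with inner integrals ending at \<open>b\<close>, is for points to
  the left. Since all intervals are closed on the left and open on the right, one piece of each
  splitting has the diagonal on the wrong side; \<open>AE_no_common_atom\<close> allows it to be
  corrected.\<close>

lemma set_integral_mult_split: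
  fixes f h :: "real \<Rightarrow> real"
  assumes "sigma_finite_measure M" "sigma_finite_measure N"
    and sM: "sets M = sets borel" and sN: "sets N = sets borel"
    and atomless: "\<And>x. emeasure M {x} = 0"
    and f: "set_integrable M {a..<b} f" and h: "set_integrable N {a..<b} h"
  shows "(LINT t:{a..<b}|M. f t) * (LINT t:{a..<b}|N. h t) =
      (LINT t:{a..<b}|N. (LINT s:{a..<t}|M. f s) * h t) + (LINT s:{a..<b}|M. f s * (LINT t:{a..<s}|N. h t))"
      (is "?P = ?forward")
    and "(LINT t:{a..<b}|M. f t) * (LINT t:{a..<b}|N. h t) =
      (LINT t:{a..<b}|N. (LINT s:{t..<b}|M. f s) * h t) + (LINT s:{a..<b}|M. f s * (LINT t:{s..<b}|N. h t))"
      (is "_ = ?backward")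
proof -
  interpret M: sigma_finite_measure M by fact
  interpret N: sigma_finite_measure N by fact
  interpret pair_sigma_finite M N ..
  note [measurable_cong] = sM sN
  have sp: "space M = UNIV" "space N = UNIV"
    using sets_eq_imp_space_eq[OF sM] sets_eq_imp_space_eq[OF sN] by simp_all
  \<comment> \<open>Cutting both functions off outside the interval lets the splitting take place on
    the whole line.\<close>
  define F where "F = (\<lambda>s. indicator {a..<b} s * f s)"
  define H where "H = (\<lambda>t. indicator {a..<b} t * h t)"
  have f': "integrable M F" and h': "integrable N H"
    using f h by (simp_all add: set_integrable_def F_def H_def)
  note [measurable] = borel_measurable_integrable[OF f'] borel_measurable_integrable[OF h']
  have null: "AE s in M. {s} \<in> null_sets N"
    using AE_no_common_atom[OF assms(1,2) sM sN atomless] by (simp add: null_sets_def sN)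
  have "{p \<in> space (M \<Otimes>\<^sub>M N). fst p < snd p} \<in> sets (M \<Otimes>\<^sub>M N)" by measurable
  moreover have "{p \<in> space (M \<Otimes>\<^sub>M N). fst p < snd p} = {(s, t). s < t}"
    by (auto simp: space_pair_measure sp)
  ultimately have Q[measurable]: "{(s, t). s < t} \<in> sets (M \<Otimes>\<^sub>M N)" by simp
  have "{p \<in> space (M \<Otimes>\<^sub>M N). snd p \<le> fst p} \<in> sets (M \<Otimes>\<^sub>M N)" by measurable
  moreover have "{p \<in> space (M \<Otimes>\<^sub>M N). snd p \<le> fst p} = {(s, t). t \<le> s}"
    by (auto simp: space_pair_measure sp)
  ultimately have R[measurable]: "{(s, t). t \<le> s} \<in> sets (M \<Otimes>\<^sub>M N)" by simp
  have P: "?P = (\<integral>s. F s \<partial>M) * (\<integral>t. H t \<partial>N)"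
    by (simp add: set_lebesgue_integral_def F_def H_def)
  have drop: "(\<integral>t. i t * H t \<partial>N) = (\<integral>t. j t * H t \<partial>N)"
    if "{s} \<in> null_sets N" "\<And>t. t \<noteq> s \<Longrightarrow> i t = j t"
      and [measurable]: "i \<in> borel_measurable borel" "j \<in> borel_measurable borel" for s i j
    using AE_not_in[OF that(1)] that(2) by (intro integral_cong_AE) auto
  have "?P = (\<integral>t. H t * (\<integral>s. indicator {(s, t). s < t} (s, t) * F s \<partial>M) \<partial>N) +
      (\<integral>s. F s * (\<integral>t. indicator (- {(s, t). s < t}) (s, t) * H t \<partial>N) \<partial>M)"
    unfolding P by (rule integral_mult_split[OF f' h' Q])
  \<comment> \<open>The complement of \<open>s < t\<close> contains the diagonal, but the inner
    interval \<open>{a..<s}\<close> omits \<open>s\<close>: the diagonal is dropped for almost every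
    \<open>s\<close>.\<close>
  also have "(\<integral>s. F s * (\<integral>t. indicator (- {(s, t). s < t}) (s, t) * H t \<partial>N) \<partial>M) =
      (\<integral>s. F s * (\<integral>t. indicator {(s, t). t < s} (s, t) * H t \<partial>N) \<partial>M)"
  proof (rule integral_cong_AE)
    show "AE s in M. F s * (\<integral>t. indicator (- {(s, t). s < t}) (s, t) * H t \<partial>N) =
        F s * (\<integral>t. indicator {(s, t). t < s} (s, t) * H t \<partial>N)"
      using null
    proof eventually_elim
      case (elim s)
      then show ?case
        by (subst drop[OF elim, of _ "\<lambda>t. indicator {..<s} t"]) (auto simp: indicator_def)
    qed
  qed (simp_all add: indicator_def)
  also have "(\<integral>t. H t * (\<integral>s. indicator {(s, t). s < t} (s, t) * F s \<partial>M) \<partial>N) +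
      (\<integral>s. F s * (\<integral>t. indicator {(s, t). t < s} (s, t) * H t \<partial>N) \<partial>M) = ?forward"
    unfolding set_lebesgue_integral_def F_def H_def
    by (intro arg_cong2[where f = "(+)"] Bochner_Integration.integral_cong refl)
      (auto split: split_indicator intro!: Bochner_Integration.integral_cong)
  finally show "?P = ?forward" .
  have "?P = (\<integral>t. H t * (\<integral>s. indicator {(s, t). t \<le> s} (s, t) * F s \<partial>M) \<partial>N) +
      (\<integral>s. F s * (\<integral>t. indicator (- {(s, t). t \<le> s}) (s, t) * H t \<partial>N) \<partial>M)"
    unfolding P by (rule integral_mult_split[OF f' h' R])
  \<comment> \<open>Now the complement is the strict region \<open>s < t\<close>, while
    \<open>{s..<b}\<close> contains \<open>s\<close>: the diagonal is added instead.\<close>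
  also have "(\<integral>s. F s * (\<integral>t. indicator (- {(s, t). t \<le> s}) (s, t) * H t \<partial>N) \<partial>M) =
      (\<integral>s. F s * (\<integral>t. indicator {(s, t). s \<le> t} (s, t) * H t \<partial>N) \<partial>M)"
  proof (rule integral_cong_AE)
    show "AE s in M. F s * (\<integral>t. indicator (- {(s, t). t \<le> s}) (s, t) * H t \<partial>N) =
        F s * (\<integral>t. indicator {(s, t). s \<le> t} (s, t) * H t \<partial>N)"
      using null
    proof eventually_elim
      case (elim s)
      then show ?case
        by (subst drop[OF elim, of _ "\<lambda>t. indicator {s..} t"]) (auto simp: indicator_def)
    qed
  qed (simp_all add: indicator_def)
  also have "(\<integral>t. H t * (\<integral>s. indicator {(s, t). t \<le> s} (s, t) * F s \<partial>M) \<partial>N) +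
      (\<integral>s. F s * (\<integral>t. indicator {(s, t). s \<le> t} (s, t) * H t \<partial>N) \<partial>M) = ?backward"
    unfolding set_lebesgue_integral_def F_def H_def
    by (intro arg_cong2[where f = "(+)"] Bochner_Integration.integral_cong refl)
      (auto split: split_indicator intro!: Bochner_Integration.integral_cong)
  finally show "?P = ?backward" .
qed

section \<open>Signed integrals from the centre\<close>

text \<open>True for indicators by hypothesis, and preserved by scaling, sums and increasing
  limits.\<close>

lemma nn_integral_measure_add:
  assumes sM: "sets M = sets L" and sN: "sets N = sets L"
    and add: "\<And>A. A \<in> sets L \<Longrightarrow> emeasure L A = emeasure M A + emeasure N A"
    and "f \<in> borel_measurable L"
  shows "(\<integral>\<^sup>+x. f x \<partial>L) = (\<integral>\<^sup>+x. f x \<partial>M) + (\<integral>\<^sup>+x. f x \<partial>N)"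
  using assms(4)
proof (induction rule: borel_measurable_induct)
  case (cong f g)
  have "space M = space L" "space N = space L"
    using sM sN by (auto dest: sets_eq_imp_space_eq)
  with cong(3) have "(\<integral>\<^sup>+x. f x \<partial>K) = (\<integral>\<^sup>+x. g x \<partial>K)" if "K \<in> {L, M, N}" for K
    using that by (intro nn_integral_cong) auto
  with cong(4) show ?case by simp
next
  case (set A)
  then show ?case using add sM sN by simp
next
  case (mult u c)
  then have [measurable]: "u \<in> borel_measurable M" "u \<in> borel_measurable N"
    using sM sN by (simp_all cong: measurable_cong_sets)
  show ?case using mult by (simp add: nn_integral_cmult distrib_left)
next
  case (add u v)
  then have [measurable]: "u \<in> borel_measurable M" "v \<in> borel_measurable M"
    "u \<in> borel_measurable N" "v \<in> borel_measurable N"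
    using sM sN by (simp_all cong: measurable_cong_sets)
  show ?case using add by (simp add: nn_integral_add ac_simps)
next
  case (seq U)
  have [measurable]: "U i \<in> borel_measurable M" "U i \<in> borel_measurable N" for i
    using sM sN seq by (simp_all cong: measurable_cong_sets)
  have "(\<integral>\<^sup>+x. (SUP i. U i) x \<partial>L) = (SUP i. \<integral>\<^sup>+x. U i x \<partial>L)"
    using seq by (simp add: nn_integral_monotone_convergence_SUP image_comp)
  also have "\<dots> = (SUP i. (\<integral>\<^sup>+x. U i x \<partial>M) + (\<integral>\<^sup>+x. U i x \<partial>N))"
    using seq by simp
  \<comment> \<open>Supremum and sum commute because both sequences of integrals are
    increasing.\<close>
  also have "\<dots> = (SUP i. \<integral>\<^sup>+x. U i x \<partial>M) + (SUP i. \<integral>\<^sup>+x. U i x \<partial>N)"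
    using seq by (intro ennreal_SUP_add incseq_nn_integral)
  also have "\<dots> = (\<integral>\<^sup>+x. (SUP i. U i) x \<partial>M) + (\<integral>\<^sup>+x. (SUP i. U i) x \<partial>N)"
    using seq by (simp add: nn_integral_monotone_convergence_SUP image_comp)
  finally show ?case .
qed

text \<open>The integrals of the absolute value over \<open>M\<close> and \<open>N\<close> add up to
  the finite one over \<open>L\<close>, so \<open>f\<close> is integrable for both. Its positive and
  negative parts can then be added separately.\<close>

lemma integral_measure_add:
  fixes f :: "'a \<Rightarrow> real"
  assumes sM: "sets M = sets L" and sN: "sets N = sets L"
    and add: "\<And>A. A \<in> sets L \<Longrightarrow> emeasure L A = emeasure M A + emeasure N A"
    and f: "integrable L f"
  shows "(\<integral>x. f x \<partial>L) = (\<integral>x. f x \<partial>M) + (\<integral>x. f x \<partial>N)"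
proof -
  note nn = nn_integral_measure_add[OF sM sN add]
  have [measurable]: "f \<in> borel_measurable L" using f by simp
  then have [measurable]: "f \<in> borel_measurable M" "f \<in> borel_measurable N"
    using sM sN by (simp_all cong: measurable_cong_sets)
  have "(\<integral>\<^sup>+x. norm (f x) \<partial>M) + (\<integral>\<^sup>+x. norm (f x) \<partial>N) < \<infinity>"
    using f by (simp add: integrable_iff_bounded nn)
  then have "integrable M f" "integrable N f"
    by (simp_all add: integrable_iff_bounded)
  \<comment> \<open>\<open>enn2real\<close> sends infinity to 0, so its additivity relies on finite
    values.\<close>
  moreover have "enn2real (x + y) = enn2real x + enn2real y" if "x < \<infinity>" "y < \<infinity>" for x y
    using that by (simp add: enn2real_plus)
  ultimately show ?thesis
    using f by (simp add: real_lebesgue_integral_def real_integrable_def nn less_top[symmetric])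
qed

text \<open>A class that contains the monomials, is stable under products and indefinite integrals,
  and is integrable over bounded intervals against every Stieltjes measure. Local boundedness takes
  the place of continuity because monomials may jump.\<close>

definition locally_bounded_borel :: "(real \<Rightarrow> real) \<Rightarrow> bool" where
  "locally_bounded_borel f \<longleftrightarrow> f \<in> borel_measurable borel \<and> (\<forall>R. \<exists>K. \<forall>t. \<bar>t\<bar> \<le> R \<longrightarrow> \<bar>f t\<bar> \<le> K)"

lemma locally_bounded_borel_const: "locally_bounded_borel (\<lambda>x. c)"
  by (auto simp: locally_bounded_borel_def)

lemma locally_bounded_borel_mult:
  assumes "locally_bounded_borel f" "locally_bounded_borel h"
  shows "locally_bounded_borel (\<lambda>x. f x * h x)"
  unfolding locally_bounded_borel_def
proof (intro conjI allI)
  show "(\<lambda>x. f x * h x) \<in> borel_measurable borel"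
    using assms by (auto simp: locally_bounded_borel_def)
  fix R
  obtain K1 K2 where "\<And>t. \<bar>t\<bar> \<le> R \<Longrightarrow> \<bar>f t\<bar> \<le> K1" "\<And>t. \<bar>t\<bar> \<le> R \<Longrightarrow> \<bar>h t\<bar> \<le> K2"
    using assms by (auto simp: locally_bounded_borel_def) metis
  then have "\<bar>f t * h t\<bar> \<le> K1 * K2" if "\<bar>t\<bar> \<le> R" for t
    unfolding abs_mult using that by (intro mult_mono') auto
  then show "\<exists>K. \<forall>t. \<bar>t\<bar> \<le> R \<longrightarrow> \<bar>f t * h t\<bar> \<le> K" by blast
qed

lemma set_integrable_stieltjes:
  assumes "derivator g" "locally_bounded_borel f"
  shows "set_integrable (stieltjes g) {a..<b} f"
proof -
  obtain K where K: "\<And>t. \<bar>t\<bar> \<le> max \<bar>a\<bar> \<bar>b\<bar> \<Longrightarrow> \<bar>f t\<bar> \<le> K"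
    using assms(2) unfolding locally_bounded_borel_def by blast
  have fin: "emeasure (stieltjes g) {a..<b} < \<infinity>"
    using emeasure_stieltjes[OF assms(1), of a b] by (cases "a \<le> b") auto
  show ?thesis unfolding set_integrable_def
  proof (rule integrableI_bounded_set_indicator[OF _ _ fin])
    show "AE x in stieltjes g. x \<in> {a..<b} \<longrightarrow> norm (f x) \<le> K"
      using K by auto
  qed (use assms(2) in \<open>auto simp: locally_bounded_borel_def\<close>)
qed

text \<open>The oriented integral from \<open>x0\<close> to \<open>x\<close>. Its sign convention
  gives the monomial recursion and the product rule the same form on both sides of the
  centre.\<close>

definition stieltjes_from :: "(real \<Rightarrow> real) \<Rightarrow> real \<Rightarrow> (real \<Rightarrow> real) \<Rightarrow> real \<Rightarrow> real" where
  "stieltjes_from h x0 f x = (if x0 \<le> x then LINT t:{x0..<x}|stieltjes h. f t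
     else - (LINT t:{x..<x0}|stieltjes h. f t))"

lemma monomial_Suc_eq:
  "monomial h x0 (Suc n) = (\<lambda>x. real (Suc n) * stieltjes_from h x0 (monomial h x0 n) x)"
  by (auto simp: stieltjes_from_def fun_eq_iff algebra_simps)

lemma stieltjes_from_cmult:
  "stieltjes_from h x0 (\<lambda>t. c * f t) x = c * stieltjes_from h x0 f x"
  by (simp add: stieltjes_from_def)

lemma stieltjes_from_sum:
  assumes "derivator h" "\<And>i. i \<in> I \<Longrightarrow> locally_bounded_borel (f i)"
  shows "stieltjes_from h x0 (\<lambda>t. \<Sum>i\<in>I. f i t) x = (\<Sum>i\<in>I. stieltjes_from h x0 (f i) x)"
proof -
  have "(LINT t:{a..<b}|stieltjes h. \<Sum>i\<in>I. f i t) = (\<Sum>i\<in>I. LINT t:{a..<b}|stieltjes h. f i t)" for a b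
    using set_integrable_stieltjes[OF assms(1), of "f _" a b] assms(2)
    unfolding set_lebesgue_integral_def set_integrable_def
    by (simp add: sum_distrib_left)
  then show ?thesis by (simp add: stieltjes_from_def sum_negf)
qed

lemma stieltjes_from_add_derivator:
  assumes "derivator u" "derivator v" "locally_bounded_borel f"
  shows "stieltjes_from (\<lambda>x. u x + v x) x0 f x = stieltjes_from u x0 f x + stieltjes_from v x0 f x"
proof -
  have "(LINT t:{a..<b}|stieltjes (\<lambda>x. u x + v x). f t) =
      (LINT t:{a..<b}|stieltjes u. f t) + (LINT t:{a..<b}|stieltjes v. f t)" for a b
    unfolding set_lebesgue_integral_def
    using set_integrable_stieltjes[OF derivator_add[OF assms(1,2)] assms(3)] emeasure_stieltjes_add[OF assms(1,2)]
    by (intro integral_measure_add) (auto simp: set_integrable_def)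
  then show ?thesis by (simp add: stieltjes_from_def)
qed

lemma locally_bounded_borel_stieltjes_from:
  assumes h: "derivator h" and f: "locally_bounded_borel f"
  shows "locally_bounded_borel (stieltjes_from h x0 f)"
  unfolding locally_bounded_borel_def
proof (intro conjI allI)
  interpret sigma_finite_measure "stieltjes h" by (rule sigma_finite_stieltjes[OF h])
  have [measurable]: "f \<in> borel_measurable borel"
    using f by (simp add: locally_bounded_borel_def)
  show "stieltjes_from h x0 f \<in> borel_measurable borel"
    \<comment> \<open>With the indicator written as a condition on the endpoint, the integrand is
      jointly measurable; sigma-finiteness then makes the integral measurable in the
      endpoint.\<close>
    unfolding stieltjes_from_def[abs_def] set_lebesgue_integral_def indicator_def atLeastLessThan_iff by measurable
  fix R
  \<comment> \<open>\<open>S\<close> also covers the centre, so every interval between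
    \<open>x0\<close> and a point of modulus at most \<open>R\<close> lies in
    \<open>{- S..<S}\<close>, and one integral bounds them all.\<close>
  define S where "S = max R \<bar>x0\<bar>"
  have I: "set_integrable (stieltjes h) {a..<b} f" for a b
    by (rule set_integrable_stieltjes[OF h f])
  have le: "\<bar>LINT t:{a..<b}|stieltjes h. f t\<bar> \<le> (LINT t:{- S..<S}|stieltjes h. \<bar>f t\<bar>)"
    if "\<bar>a\<bar> \<le> S" "\<bar>b\<bar> \<le> S" for a b
  proof -
    have "\<bar>LINT t:{a..<b}|stieltjes h. f t\<bar> \<le> (LINT t:{a..<b}|stieltjes h. \<bar>f t\<bar>)"
      using set_integral_norm_bound[OF I] by simp
    also have "\<dots> \<le> (LINT t:{- S..<S}|stieltjes h. \<bar>f t\<bar>)"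
      using set_integrable_abs[OF I] that
      unfolding set_lebesgue_integral_def set_integrable_def
      by (intro integral_mono) (auto split: split_indicator)
    finally show ?thesis .
  qed
  then have "\<forall>t. \<bar>t\<bar> \<le> R \<longrightarrow> \<bar>stieltjes_from h x0 f t\<bar> \<le> (LINT t:{- S..<S}|stieltjes h. \<bar>f t\<bar>)"
    by (auto simp: stieltjes_from_def S_def)
  then show "\<exists>K. \<forall>t. \<bar>t\<bar> \<le> R \<longrightarrow> \<bar>stieltjes_from h x0 f t\<bar> \<le> K" by blast
qed

lemma locally_bounded_borel_monomial:
  assumes "derivator h"
  shows "locally_bounded_borel (monomial h x0 n)"
proof (induction n)
  case 0
  then show ?case by (simp add: locally_bounded_borel_const)
next
  case (Suc n)
  then show ?case unfolding monomial_Suc_eq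
    by (intro locally_bounded_borel_mult locally_bounded_borel_const
        locally_bounded_borel_stieltjes_from[OF assms])
qed

section \<open>The binomial formula\<close>

text \<open>To the left of the centre the two minus signs of the factors cancel, and in each term on
  the right the sign of the outer integral cancels that of the inner one.\<close>

lemma stieltjes_from_mult:
  assumes u: "derivator u" and v: "derivator v"
    and atomless: "\<And>x. emeasure (stieltjes u) {x} = 0"
    and f: "locally_bounded_borel f" and h: "locally_bounded_borel h"
  shows "stieltjes_from u x0 f x * stieltjes_from v x0 h x =
    stieltjes_from u x0 (\<lambda>t. f t * stieltjes_from v x0 h t) x +
    stieltjes_from v x0 (\<lambda>t. stieltjes_from u x0 f t * h t) x"
proof (cases "x0 \<le> x")
  case True
  have "(LINT t:{x0..<x}|stieltjes v. (LINT s:{x0..<t}|stieltjes u. f s) * h t) =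
      (LINT t:{x0..<x}|stieltjes v. stieltjes_from u x0 f t * h t)"
    by (rule set_lebesgue_integral_cong) (auto simp: stieltjes_from_def)
  moreover have "(LINT s:{x0..<x}|stieltjes u. f s * (LINT t:{x0..<s}|stieltjes v. h t)) =
      (LINT s:{x0..<x}|stieltjes u. f s * stieltjes_from v x0 h s)"
    by (rule set_lebesgue_integral_cong) (auto simp: stieltjes_from_def)
  ultimately show ?thesis
    using set_integral_mult_split(1)[OF sigma_finite_stieltjes[OF u] sigma_finite_stieltjes[OF v] _ _ atomless
        set_integrable_stieltjes[OF u f] set_integrable_stieltjes[OF v h], of x0 x] True
    by (simp add: stieltjes_from_def)
next
  case False
  have "(LINT t:{x..<x0}|stieltjes v. (LINT s:{t..<x0}|stieltjes u. f s) * h t) =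
      (LINT t:{x..<x0}|stieltjes v. - (stieltjes_from u x0 f t * h t))"
    by (rule set_lebesgue_integral_cong) (auto simp: stieltjes_from_def)
  moreover have "(LINT s:{x..<x0}|stieltjes u. f s * (LINT t:{s..<x0}|stieltjes v. h t)) =
      (LINT s:{x..<x0}|stieltjes u. - (f s * stieltjes_from v x0 h s))"
    by (rule set_lebesgue_integral_cong) (auto simp: stieltjes_from_def)
  moreover have neg: "(LINT t:{x..<x0}|M. - p t) = - (LINT t:{x..<x0}|M. p t)"
    for M and p :: "real \<Rightarrow> real"
    by (simp add: set_lebesgue_integral_def)
  ultimately show ?thesis
    using set_integral_mult_split(2)[OF sigma_finite_stieltjes[OF u] sigma_finite_stieltjes[OF v] _ _ atomless
        set_integrable_stieltjes[OF u f] set_integrable_stieltjes[OF v h], of x x0] False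
    by (simp add: stieltjes_from_def neg[of "stieltjes u"] neg[of "stieltjes v"])
qed

text \<open>For k = 0 or m = 0 the truncated subtraction is harmless, as its term has the factor 0.\<close>
lemma monomial_mult:
  assumes u: "derivator u" and v: "derivator v"
    and atomless: "\<And>x. emeasure (stieltjes u) {x} = 0"
    and "0 < k + m"
  shows "monomial u x0 k x * monomial v x0 m x =
    real k * stieltjes_from u x0 (\<lambda>t. monomial u x0 (k - 1) t * monomial v x0 m t) x +
    real m * stieltjes_from v x0 (\<lambda>t. monomial u x0 k t * monomial v x0 (m - 1) t) x"
proof (cases k)
  case 0
  \<comment> \<open>Both indices being 0 is excluded: the product would be 1 and the right-hand side
    0.\<close>
  then obtain m' where "m = Suc m'" using assms(4) by (cases m) auto
  with 0 show ?thesis by (simp add: monomial_Suc_eq del: monomial.simps(2))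
next
  case k: (Suc k')
  show ?thesis
  proof (cases m)
    case 0
    with k show ?thesis by (simp add: monomial_Suc_eq del: monomial.simps(2))
  next
    case m: (Suc m')
    have "monomial u x0 k x * monomial v x0 m x = real k * real m *
        (stieltjes_from u x0 (monomial u x0 k') x * stieltjes_from v x0 (monomial v x0 m') x)"
      by (simp add: k m monomial_Suc_eq del: monomial.simps(2))
    also have "stieltjes_from u x0 (monomial u x0 k') x * stieltjes_from v x0 (monomial v x0 m') x =
        stieltjes_from u x0 (\<lambda>t. monomial u x0 k' t * stieltjes_from v x0 (monomial v x0 m') t) x +
        stieltjes_from v x0 (\<lambda>t. stieltjes_from u x0 (monomial u x0 k') t * monomial v x0 m' t) x"
      by (rule stieltjes_from_mult[OF u v atomless]) (use u v in \<open>simp_all add: locally_bounded_borel_monomial\<close>)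
    \<comment> \<open>Each term keeps one constant outside. The other moves under the integral,
      where it completes the factor \<open>stieltjes_from\<close> to a monomial of index
      \<open>m\<close> or \<open>k\<close>.\<close>
    also have "real k * real m * \<dots> =
        real k * stieltjes_from u x0 (\<lambda>t. real m * (monomial u x0 k' t * stieltjes_from v x0 (monomial v x0 m') t)) x +
        real m * stieltjes_from v x0 (\<lambda>t. real k * (stieltjes_from u x0 (monomial u x0 k') t * monomial v x0 m' t)) x"
      by (simp only: stieltjes_from_cmult distrib_left mult_ac)
    also have "(\<lambda>t. real m * (monomial u x0 k' t * stieltjes_from v x0 (monomial v x0 m') t)) =
        (\<lambda>t. monomial u x0 (k - 1) t * monomial v x0 m t)"
      by (simp add: k m monomial_Suc_eq mult_ac del: monomial.simps(2))
    also have "(\<lambda>t. real k * (stieltjes_from u x0 (monomial u x0 k') t * monomial v x0 m' t)) =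
        (\<lambda>t. monomial u x0 k t * monomial v x0 (m - 1) t)"
      by (simp add: k m monomial_Suc_eq mult_ac del: monomial.simps(2))
    finally show ?thesis .
  qed
qed

lemma monomial_add_derivator:
  assumes u: "derivator u" and v: "derivator v"
    and atomless: "\<And>x. emeasure (stieltjes u) {x} = 0"
  shows "monomial (\<lambda>x. u x + v x) x0 n x =
    (\<Sum>k=0..n. real (n choose k) * monomial u x0 k x * monomial v x0 (n - k) x)"
proof (induction n arbitrary: x)
  case 0
  then show ?case by simp
next
  case (Suc n)
  let ?g = "\<lambda>x. u x + v x" and ?U = "monomial u x0" and ?V = "monomial v x0"
  let ?u = "\<lambda>k m. stieltjes_from u x0 (\<lambda>t. ?U k t * ?V m t) x"
  let ?v = "\<lambda>k m. stieltjes_from v x0 (\<lambda>t. ?U k t * ?V m t) x"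
  let ?c = "\<lambda>k. real (n choose k)"
  have lbb: "locally_bounded_borel (\<lambda>t. c * (?U k t * ?V m t))" for c k m
    using u v by (intro locally_bounded_borel_mult locally_bounded_borel_const locally_bounded_borel_monomial)
  \<comment> \<open>An equation of functions is required, since it is used under the integral sign;
    hence the induction over arbitrary \<open>x\<close>.\<close>
  have IH: "monomial ?g x0 n = (\<lambda>t. \<Sum>k=0..n. ?c k * (?U k t * ?V (n - k) t))"
    using Suc by (simp add: fun_eq_iff mult.assoc)
  have g: "locally_bounded_borel (monomial ?g x0 n)"
    by (rule locally_bounded_borel_monomial[OF derivator_add[OF u v]])
  have "monomial ?g x0 (Suc n) x = real (Suc n) *
      (stieltjes_from u x0 (monomial ?g x0 n) x + stieltjes_from v x0 (monomial ?g x0 n) x)"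
    unfolding monomial_Suc_eq stieltjes_from_add_derivator[OF u v g] ..
  also have "\<dots> = real (Suc n) * ((\<Sum>k=0..n. ?c k * ?u k (n - k)) + (\<Sum>k=0..n. ?c k * ?v k (n - k)))"
    unfolding IH stieltjes_from_sum[OF u lbb] stieltjes_from_sum[OF v lbb] stieltjes_from_cmult ..
  also have "\<dots> = (\<Sum>k=0..n. real (Suc n choose Suc k) * real (Suc k) * ?u k (n - k)) +
      (\<Sum>k=0..n. real (Suc n choose k) * real (Suc n - k) * ?v k (n - k))"
  proof -
    \<comment> \<open>The first absorption identity fits the terms integrated against
      \<open>u\<close>, where the index of the \<open>u\<close>-monomial will rise; the second fits
      those against \<open>v\<close>, where it stays.\<close>
    have 1: "real (Suc n) * ?c k = real (Suc n choose Suc k) * real (Suc k)" for k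
      using Suc_times_binomial_eq[of n k] by (metis of_nat_mult)
    have 2: "real (Suc n) * ?c k = real (Suc n choose k) * real (Suc n - k)" if "k \<le> n" for k
      using binomial_absorb_comp[of "Suc n" k] that by (metis diff_Suc_1 mult.commute of_nat_mult)
    show ?thesis
      unfolding distrib_left sum_distrib_left mult.assoc[symmetric] 1[symmetric]
      using 2 by (auto intro!: sum.cong)
  qed
  \<comment> \<open>After the shift of \<open>k\<close> by one, the extra term \<open>k = 0\<close>
    vanishes through its factor \<open>k\<close>.\<close>
  also have "(\<Sum>k=0..n. real (Suc n choose Suc k) * real (Suc k) * ?u k (n - k)) =
      (\<Sum>k=0..Suc n. real (Suc n choose k) * real k * ?u (k - 1) (Suc n - k))"
    by (subst sum.atLeast0_atMost_Suc_shift) simp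
  \<comment> \<open>The extra term \<open>k = Suc n\<close> vanishes through its factor
    \<open>Suc n - k\<close>.\<close>
  also have "(\<Sum>k=0..n. real (Suc n choose k) * real (Suc n - k) * ?v k (n - k)) =
      (\<Sum>k=0..Suc n. real (Suc n choose k) * real (Suc n - k) * ?v k (Suc n - k - 1))"
    by (subst sum.atLeast0_atMost_Suc) simp
  \<comment> \<open>Both sums now have the same range, and \<open>monomial_mult\<close> matches them
    term by term: the two indices add up to \<open>Suc n\<close>, which is positive.\<close>
  also have "(\<Sum>k=0..Suc n. real (Suc n choose k) * real k * ?u (k - 1) (Suc n - k)) + \<dots> =
      (\<Sum>k=0..Suc n. real (Suc n choose k) * (?U k x * ?V (Suc n - k) x))"
    by (subst sum.distrib[symmetric], rule sum.cong)
      (auto simp: monomial_mult[OF u v atomless, of _ "Suc n - _"] algebra_simps simp del: monomial.simps)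
  finally show ?case by (simp only: mult.assoc)
qed

theorem theorem3p22:
  fixes g :: "real \<Rightarrow> real" and x0 x :: real and n :: nat
  assumes "derivator g"
  shows "monomial g x0 n x =
    (\<Sum>k=0..n. real (n choose k) * monomial (cont_part g) x0 k x * monomial (disc_part g) x0 (n - k) x)"
proof -
  have "g = (\<lambda>x. cont_part g x + disc_part g x)"
    by (simp add: cont_part_def)
  then show ?thesis
    using monomial_add_derivator[OF derivator_cont_part[OF assms] derivator_disc_part[OF assms]
        emeasure_stieltjes_cont_part_singleton[OF assms], of x0 n x]
    by simp
qed

end
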